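(* Let $u=(u_i)_{i\in\mathbb Z}$ be a real sequence and $N\ge 0$ an integer with $u_i=0$ for all $i\ge N$ and all $i\le -N$. Let $k\ge 0$ be real and let $A$ be either $A(\gamma)$ or $A(\delta)$. 1. If $v\in\mathbb R^{[-N-1,N+1]}$ satisfies $A_{[-N-1,N+1]}\otimes v=v$, then $v$ can be uniquely extended to $\Phi\in\mathbb R^{\mathbb Z}$ satisfying (A$\Phi$) and $A\otimes\Phi=\Phi$, such that $\Phi_{[-N-1,N+1]}=v$. 2. If $\Phi\in\mathbb R^{\mathbb Z}$ satisfies (A$\Phi$) and $A\otimes\Phi=\Phi$, then $A_{[-N-1,N+1]}\otimes\Phi_{[-N-1,N+1]}=\Phi_{[-N-1,N+1]}$.
   Context: Max-plus conventions: on $\mathbb R\cup\{-\infty\}$, $a\oplus b=\max(a,b)$, $a\otimes b=a+b$, extended to matrices and vectors in the usual way. For a real sequence $u$ and $k\in\mathbb R$ put $\gamma_i=\min(u_i,1-u_{i-1})$ and $\delta_i=\min(u_{i-1},1-u_i)$. The $\mathbb Z\times\mathbb Z$ matrix $A(\gamma)$ has entries $A(\gamma)_{i,i+1}=\gamma_i-k$, $A(\gamma)_{i,i-1}=\gamma_i$, and all other entries $-\infty$; $A(\delta)$ is defined in the same way with $\delta_i$ in place of $\gamma_i$. Condition (A$\Phi$): there exist arbitrarily large $N'$ and $N''$ with $\Phi_{N'}=\Phi_{N'+1}$ and $\Phi_{-N''-1}=\Phi_{-N''}-k$. $\Phi_{[N_1,N_2]}$ is the restriction of $\Phi$ to the integer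 interval $[N_1,N_2]$, and $A_{[N_1,N_2]}$ is the submatrix of $A$ with row and column indices in $[N_1,N_2]$.
   Formalization: Part 2 is proved under the added assumption that k > 0, or A = A(γ), or u_{N-1} ≥ 0; without it, part 2 fails for k = 0, A = A(δ), N = 1, u_0 = -1, with Φ_1 = -1 and all other Φ_i = 0. *)

theory Defs
  imports Complex_Main "HOL-Library.Extended_Real" "HOL-Library.FuncSet"
begin

text \<open>
  Max-plus scalars are elements of \<^typ>\<open>ereal\<close>: the sum of the semiring is the supremum and its
  product is \<open>+\<close>. The value \<open>\<infinity>\<close> does not occur in any matrix or vector below.
\<close>

definition mp_mult_vec :: "'i set \<Rightarrow> ('i \<Rightarrow> 'i \<Rightarrow> ereal) \<Rightarrow> ('i \<Rightarrow> ereal) \<Rightarrow> 'i \<Rightarrow> ereal" where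
  "mp_mult_vec I A x i = (SUP j\<in>I. A i j + x j)"

text \<open>
  With \<open>A\<^sub>I\<close> the submatrix of \<open>A\<close> with row and column indices in \<open>I\<close>, this is \<open>A\<^sub>I \<otimes> x = x\<close> for a
  vector \<open>x\<close> with finite entries indexed by \<open>I\<close>; the case \<open>I = UNIV\<close> is \<open>A \<otimes> x = x\<close>.
\<close>

definition mp_fixed :: "'i set \<Rightarrow> ('i \<Rightarrow> 'i \<Rightarrow> ereal) \<Rightarrow> ('i \<Rightarrow> real) \<Rightarrow> bool" where
  "mp_fixed I A x \<longleftrightarrow> (\<forall>i\<in>I. mp_mult_vec I A (\<lambda>j. ereal (x j)) i = ereal (x i))"

definition gamma_seq :: "(int \<Rightarrow> real) \<Rightarrow> int \<Rightarrow> real" where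
  "gamma_seq u i = min (u i) (1 - u (i - 1))"

definition delta_seq :: "(int \<Rightarrow> real) \<Rightarrow> int \<Rightarrow> real" where
  "delta_seq u i = min (u (i - 1)) (1 - u i)"

definition A_mat :: "real \<Rightarrow> (int \<Rightarrow> real) \<Rightarrow> int \<Rightarrow> int \<Rightarrow> ereal" where
  "A_mat k g i j =
    (if j = i + 1 then ereal (g i - k) else if j = i - 1 then ereal (g i) else - \<infinity>)"

definition cond_A :: "real \<Rightarrow> (int \<Rightarrow> real) \<Rightarrow> bool" where
  "cond_A k \<Phi> \<longleftrightarrow>
    (\<forall>M. \<exists>N'\<ge>M. \<Phi> N' = \<Phi> (N' + 1)) \<and>
    (\<forall>M. \<exists>N''\<ge>M. \<Phi> (- N'' - 1) = \<Phi> (- N'') - k)"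

lemma mp_mult_vec_A_mat_UNIV:
  "mp_mult_vec UNIV (A_mat k g) (\<lambda>j. ereal (x j)) i =
    ereal (max (g i - k + x (i + 1)) (g i + x (i - 1)))"
proof -
  have "(SUP j\<in>UNIV. A_mat k g i j + ereal (x j)) =
      ereal (max (g i - k + x (i + 1)) (g i + x (i - 1)))"
  proof (rule antisym)
    show "(SUP j\<in>UNIV. A_mat k g i j + ereal (x j)) \<le>
        ereal (max (g i - k + x (i + 1)) (g i + x (i - 1)))"
      by (rule SUP_least) (auto simp: A_mat_def)
    have "ereal (g i - k + x (i + 1)) \<le> (SUP j\<in>UNIV. A_mat k g i j + ereal (x j))"
      by (rule SUP_upper2[of "i + 1"]) (auto simp: A_mat_def)
    moreover have "ereal (g i + x (i - 1)) \<le> (SUP j\<in>UNIV. A_mat k g i j + ereal (x j))"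
      by (rule SUP_upper2[of "i - 1"]) (auto simp: A_mat_def)
    ultimately show "ereal (max (g i - k + x (i + 1)) (g i + x (i - 1))) \<le>
        (SUP j\<in>UNIV. A_mat k g i j + ereal (x j))"
      by (simp add: max_def)
  qed
  then show ?thesis by (simp add: mp_mult_vec_def)
qed

text \<open>
  For \<open>k = 0\<close> and \<open>A = A(\<delta>)\<close>, the passage from \<open>A \<otimes> \<Phi> = \<Phi>\<close> to the truncated equation fails when
  \<open>u (N - 1) < 0\<close>: take \<open>N = 1\<close>, \<open>u 0 = - 1\<close> and \<open>\<Phi> 1 = - 1\<close>, all other values being zero.
\<close>

lemma truncation_fails_for_delta:
  defines "u \<equiv> (\<lambda>i::int. if i = 0 then - 1 else 0 :: real)"
    and "\<Phi> \<equiv> (\<lambda>i::int. if i = 1 then - 1 else 0 :: real)"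
  shows "\<forall>i\<ge>1. u i = 0" and "\<forall>i\<le>- 1. u i = 0"
    and "cond_A 0 \<Phi>" and "mp_fixed UNIV (A_mat 0 (delta_seq u)) \<Phi>"
    and "\<not> mp_fixed {- 2..2} (A_mat 0 (delta_seq u)) (restrict \<Phi> {- 2..2})"
proof -
  show "\<forall>i\<ge>1. u i = 0" and "\<forall>i\<le>- 1. u i = 0"
    by (auto simp: u_def)
  show "cond_A 0 \<Phi>"
    unfolding cond_A_def
  proof (intro conjI allI)
    fix M :: int
    show "\<exists>N'\<ge>M. \<Phi> N' = \<Phi> (N' + 1)"
      by (rule exI[of _ "max M 2"]) (auto simp: \<Phi>_def)
    show "\<exists>N''\<ge>M. \<Phi> (- N'' - 1) = \<Phi> (- N'') - 0"
      by (rule exI[of _ "max M 2"]) (auto simp: \<Phi>_def max_def)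
  qed
  show "mp_fixed UNIV (A_mat 0 (delta_seq u)) \<Phi>"
    by (auto simp: mp_fixed_def mp_mult_vec_A_mat_UNIV delta_seq_def u_def \<Phi>_def)
  have "mp_mult_vec {- 2..2} (A_mat 0 (delta_seq u))
      (\<lambda>j. ereal (restrict \<Phi> {- 2..2} j)) 2 \<le> ereal (- 1)"
    unfolding mp_mult_vec_def
    by (rule SUP_least) (auto simp: A_mat_def delta_seq_def u_def \<Phi>_def)
  also have "\<dots> < ereal (restrict \<Phi> {- 2..2} 2)"
    by (simp add: \<Phi>_def)
  finally show "\<not> mp_fixed {- 2..2} (A_mat 0 (delta_seq u)) (restrict \<Phi> {- 2..2})"
    unfolding mp_fixed_def by (metis atLeastAtMost_iff less_irrefl neg_numeral_le_numeral order_refl)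
qed

end

theory Submission
  imports Defs
begin

text \<open>
  Both sequences \<open>\<gamma>\<close> and \<open>\<delta>\<close> vanish at indices \<open>i > N\<close> and \<open>i \<le> - N\<close>, so there the eigenvector
  equation reads \<open>\<Phi> i = max (\<Phi> (i + 1) - k) (\<Phi> (i - 1))\<close>. Hence \<open>\<Phi>\<close> is nondecreasing to the right,
  and an equality \<open>\<Phi> n = \<Phi> (n + 1)\<close> far out propagates back (for \<open>k = 0\<close> the equation itself makes
  \<open>\<Phi>\<close> constant), so \<open>\<Phi>\<close> is constant on the right tail. The substitution \<open>j \<mapsto> \<Phi> (- j) + k j\<close> preserves
  the recursion and shows that \<open>\<Phi>\<close> is affine of slope \<open>k\<close> on the left tail. The boundary rows of the
  truncated equation say exactly that these tails match the window. For \<open>k = 0\<close> the right boundary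
  row needs the entry at \<open>N\<close> to be nonnegative; for \<open>\<gamma>\<close> this holds because otherwise nonpositivity of
  all 2-cycles would force \<open>u (i - 1) + u i \<ge> 2\<close> for all \<open>i < N\<close>.
\<close>

section \<open>Max-plus products as row equations\<close>

lemma mp_mult_vec_A_mat:
  "mp_mult_vec I (A_mat k g) (\<lambda>j. ereal (x j)) i =
    max (if i + 1 \<in> I then ereal (g i - k + x (i + 1)) else - \<infinity>)
      (if i - 1 \<in> I then ereal (g i + x (i - 1)) else - \<infinity>)" (is "_ = ?m")
  unfolding mp_mult_vec_def
proof (rule antisym)
  show "(SUP j\<in>I. A_mat k g i j + ereal (x j)) \<le> ?m"
    by (rule SUP_least) (auto simp: A_mat_def le_max_iff_disj)
  have "ereal (g i - k + x (i + 1)) \<le> (SUP j\<in>I. A_mat k g i j + ereal (x j))" if "i + 1 \<in> I"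
    using that by (intro SUP_upper2[of "i + 1"]) (auto simp: A_mat_def)
  moreover have "ereal (g i + x (i - 1)) \<le> (SUP j\<in>I. A_mat k g i j + ereal (x j))" if "i - 1 \<in> I"
    using that by (intro SUP_upper2[of "i - 1"]) (auto simp: A_mat_def)
  ultimately show "?m \<le> (SUP j\<in>I. A_mat k g i j + ereal (x j))"
    by auto
qed

lemma mp_fixed_restrict: "mp_fixed I A (restrict x I) \<longleftrightarrow> mp_fixed I A x"
  by (simp add: mp_fixed_def mp_mult_vec_def)

lemma mp_fixed_A_mat_UNIV:
  "mp_fixed UNIV (A_mat k g) x \<longleftrightarrow> (\<forall>i. x i = max (g i - k + x (i + 1)) (g i + x (i - 1)))"
  unfolding mp_fixed_def mp_mult_vec_A_mat_UNIV ereal.inject ball_UNIV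
  by (intro iff_allI eq_commute)

lemma mp_fixed_A_mat_row:
  assumes "mp_fixed UNIV (A_mat k g) x"
  shows "x i = max (g i - k + x (i + 1)) (g i + x (i - 1))"
  using spec[OF iffD1[OF mp_fixed_A_mat_UNIV assms], of i] .

text \<open>At each end of the interval one neighbour is cut off, so the maximum shrinks to a single
  term; only these two rows differ from the full equation.\<close>

lemma mp_fixed_A_mat_interval:
  assumes "a < b"
  shows "mp_fixed {a..b} (A_mat k g) x \<longleftrightarrow>
    x a = g a - k + x (a + 1) \<and> x b = g b + x (b - 1) \<and>
    (\<forall>i. a < i \<and> i < b \<longrightarrow> x i = max (g i - k + x (i + 1)) (g i + x (i - 1)))"
proof -
  define M where "M = mp_mult_vec {a..b} (A_mat k g) (\<lambda>j. ereal (x j))"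
  have M: "M a = ereal (g a - k + x (a + 1))" "M b = ereal (g b + x (b - 1))"
    "a < i \<Longrightarrow> i < b \<Longrightarrow> M i = ereal (max (g i - k + x (i + 1)) (g i + x (i - 1)))" for i
    using assms by (auto simp: M_def mp_mult_vec_A_mat max_def)
  have "(\<forall>i\<in>{a..b}. M i = ereal (x i)) \<longleftrightarrow>
      ereal (x a) = M a \<and> ereal (x b) = M b \<and> (\<forall>i. a < i \<and> i < b \<longrightarrow> ereal (x i) = M i)"
    using assms by (auto simp: order_le_less)
  then show ?thesis
    unfolding mp_fixed_def M_def[symmetric] by (simp add: M del: ereal_max)
qed

section \<open>Tails of eigenvectors\<close>

lemma max_recursion_tail_step:
  fixes y :: "int \<Rightarrow> real"
  assumes rec: "\<And>i. i \<ge> m \<Longrightarrow> y i = max (y (i + 1) - k) (y (i - 1))"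
    and "k \<ge> 0"
    and ev: "\<forall>M. \<exists>n\<ge>M. y n = y (n + 1)"
    and i: "i \<ge> m \<or> k > 0 \<and> i = m - 1"
  shows "y (i + 1) = y i"
proof (cases "k > 0")
  case True
  obtain n where n: "n \<ge> i" "y n = y (n + 1)"
    using ev by blast
  \<comment> \<open>Since \<open>k > 0\<close>, the equality \<open>y j = y (j + 1)\<close> leaves
    only \<open>y (j - 1)\<close> to attain the maximum in row \<open>j\<close>. Row
    \<open>m\<close> thus gives the equality at \<open>m - 1\<close>, one index below the range of
    the recursion.\<close>
  have "j \<ge> m - 1 \<longrightarrow> y j = y (j + 1)" if "j \<le> n" for j
    using that
  proof (induction j rule: int_le_induct)
    case base
    show ?case using n by simp
  next
    case (step j)
    show ?case
      using step rec[of j] True by (auto simp: max_def split: if_splits)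
  qed
  from this[OF n(1)] i show ?thesis by auto
next
  case False
  with \<open>k \<ge> 0\<close> i have "k = 0" "i \<ge> m" by auto
  \<comment> \<open>For \<open>k = 0\<close>, rows \<open>i\<close> and \<open>i + 1\<close> give
    the two opposite inequalities. Both rows must lie in the range of the recursion, so
    \<open>i = m - 1\<close> is out of reach.\<close>
  moreover have "y (i + 1) = max (y (i + 1 + 1) - k) (y i)"
    using rec[of "i + 1"] \<open>i \<ge> m\<close> by simp
  ultimately show ?thesis
    using rec[of i] by linarith
qed

lemma right_tail_const:
  fixes \<Phi> :: "int \<Rightarrow> real"
  assumes "mp_fixed UNIV (A_mat k g) \<Phi>" "cond_A k \<Phi>" "k \<ge> 0"
    and "\<And>i. i \<ge> m \<Longrightarrow> g i = 0"
    and "i \<ge> m \<or> k > 0 \<and> i = m - 1"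
  shows "\<Phi> (i + 1) = \<Phi> i"
proof (rule max_recursion_tail_step[where m = m and k = k])
  show "\<Phi> i = max (\<Phi> (i + 1) - k) (\<Phi> (i - 1))" if "i \<ge> m" for i
  proof -
    have "\<Phi> i = max (g i - k + \<Phi> (i + 1)) (g i + \<Phi> (i - 1))"
      using mp_fixed_A_mat_row[OF assms(1)] .
    then show ?thesis using assms(4)[OF that] by simp
  qed
  show "\<forall>M. \<exists>n\<ge>M. \<Phi> n = \<Phi> (n + 1)"
    using assms(2) by (simp add: cond_A_def)
qed (use assms in auto)

lemma left_tail_slope:
  fixes \<Phi> :: "int \<Rightarrow> real"
  assumes fixed: "mp_fixed UNIV (A_mat k g) \<Phi>" and "cond_A k \<Phi>" "k \<ge> 0"
    and g: "\<And>i. i \<le> m \<Longrightarrow> g i = 0"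
    and "i \<le> m"
  shows "\<Phi> (i - 1) = \<Phi> i - k"
proof -
  \<comment> \<open>Reflection swaps the neighbours, and the linear term moves \<open>- k\<close>
    from one to the other. The equality \<open>y n = y (n + 1)\<close> is then the left half of
    \<open>cond_A\<close>.\<close>
  define y where "y j = \<Phi> (- j) + k * of_int j" for j
  have y_Suc: "y (j + 1) = \<Phi> (- j - 1) + k * of_int j + k" for j
  proof -
    have "- (j + 1) = - j - 1" by simp
    then show ?thesis
      by (simp only: y_def) (simp add: algebra_simps)
  qed
  have "y (- i + 1) = y (- i)"
  proof (rule max_recursion_tail_step[where m = "- m" and k = k])
    show "y j = max (y (j + 1) - k) (y (j - 1))" if "j \<ge> - m" for j
    proof -
      have "\<Phi> (- j) = max (g (- j) - k + \<Phi> (- j + 1)) (g (- j) + \<Phi> (- j - 1))"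
        using mp_fixed_A_mat_row[OF fixed] .
      moreover have "g (- j) = 0" using g that by simp
      moreover have "y (j - 1) = \<Phi> (- j + 1) + k * of_int j - k" "y j = \<Phi> (- j) + k * of_int j"
        by (simp_all add: y_def algebra_simps)
      ultimately show ?thesis
        using y_Suc[of j] by linarith
    qed
    show "\<forall>M. \<exists>n\<ge>M. y n = y (n + 1)"
    proof
      fix M :: int
      obtain n where "n \<ge> M" "\<Phi> (- n - 1) = \<Phi> (- n) - k"
        using \<open>cond_A k \<Phi>\<close> by (auto simp: cond_A_def)
      then show "\<exists>n\<ge>M. y n = y (n + 1)"
        by (intro exI[of _ n]) (simp add: y_Suc, simp add: y_def)
    qed
  qed (use assms in auto)
  then show ?thesis
    by (simp add: y_def algebra_simps)
qed

section \<open>Extension from the window and restriction to it\<close>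

lemma eigenvector_unique:
  fixes \<Phi> \<Psi> :: "int \<Rightarrow> real"
  assumes "mp_fixed UNIV (A_mat k g) \<Phi>" "cond_A k \<Phi>"
    and "mp_fixed UNIV (A_mat k g) \<Psi>" "cond_A k \<Psi>"
    and "k \<ge> 0" "a \<le> b"
    and right: "\<And>i. i \<ge> b \<Longrightarrow> g i = 0"
    and left: "\<And>i. i \<le> a \<Longrightarrow> g i = 0"
    and eq: "\<And>i. a \<le> i \<Longrightarrow> i \<le> b \<Longrightarrow> \<Phi> i = \<Psi> i"
  shows "\<Phi> = \<Psi>"
proof
  fix i
  have "\<Phi> i = \<Psi> i" if "i \<ge> b"
    using that
  proof (induction i rule: int_ge_induct)
    case base
    show ?case using eq \<open>a \<le> b\<close> by simp
  next
    case (step i)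
    then show ?case
      using right_tail_const[OF assms(1,2,5) right] right_tail_const[OF assms(3,4,5) right] by simp
  qed
  moreover have "\<Phi> i = \<Psi> i" if "i \<le> a"
    using that
  proof (induction i rule: int_le_induct)
    case base
    show ?case using eq \<open>a \<le> b\<close> by simp
  next
    case (step i)
    then show ?case
      using left_tail_slope[OF assms(1,2,5) left] left_tail_slope[OF assms(3,4,5) left] by simp
  qed
  ultimately show "\<Phi> i = \<Psi> i"
    using eq[of i] by linarith
qed

lemma eigenvector_extension:
  fixes v :: "int \<Rightarrow> real"
  assumes fixed: "mp_fixed {a..b} (A_mat k g) v" and "k \<ge> 0" "a < b"
    and right: "\<And>i. i \<ge> b \<Longrightarrow> g i = 0"
    and left: "\<And>i. i \<le> a \<Longrightarrow> g i = 0"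
  obtains \<Phi> where "mp_fixed UNIV (A_mat k g) \<Phi>" "cond_A k \<Phi>"
    "\<And>i. a \<le> i \<Longrightarrow> i \<le> b \<Longrightarrow> \<Phi> i = v i"
proof
  \<comment> \<open>\<open>right_tail_const\<close> and \<open>left_tail_slope\<close> force this
    choice of tails.\<close>
  define \<Phi> where "\<Phi> i = (if i > b then v b else if i < a then v a + k * of_int (i - a) else v i)" for i
  have va: "v a = v (a + 1) - k" and vb: "v b = v (b - 1)"
    and inner: "\<And>i. a < i \<Longrightarrow> i < b \<Longrightarrow> v i = max (g i - k + v (i + 1)) (g i + v (i - 1))"
    using fixed left[of a] right[of b] unfolding mp_fixed_A_mat_interval[OF \<open>a < b\<close>] by auto
  show "mp_fixed UNIV (A_mat k g) \<Phi>"
    unfolding mp_fixed_A_mat_UNIV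
  proof
    fix i
    consider "i < a" | "i = a" | "a < i" "i < b" | "i = b" | "i > b"
      by linarith
    then show "\<Phi> i = max (g i - k + \<Phi> (i + 1)) (g i + \<Phi> (i - 1))"
    proof cases
      case 1
      \<comment> \<open>If \<open>i + 1 = a\<close>, the value comes from \<open>v\<close>, and the
        affine formula agrees with it there.\<close>
      then have "\<Phi> (i + 1) = v a + k * of_int (i + 1 - a)"
        using \<open>a < b\<close> by (cases "i + 1 = a") (auto simp: \<Phi>_def)
      with 1 show ?thesis
        using \<open>k \<ge> 0\<close> \<open>a < b\<close> left[of i] by (simp add: \<Phi>_def algebra_simps)
    next
      case 2
      then show ?thesis
        using \<open>k \<ge> 0\<close> \<open>a < b\<close> left[of i] va by (simp add: \<Phi>_def)
    next
      case 3
      then show ?thesis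
        using inner by (simp add: \<Phi>_def)
    next
      case 4
      then show ?thesis
        using \<open>k \<ge> 0\<close> \<open>a < b\<close> right[of i] vb by (simp add: \<Phi>_def)
    next
      case 5
      then have "\<Phi> (i - 1) = v b"
        using \<open>a < b\<close> by (cases "i - 1 = b") (auto simp: \<Phi>_def)
      with 5 show ?thesis
        using \<open>k \<ge> 0\<close> right[of i] by (simp add: \<Phi>_def)
    qed
  qed
  show "cond_A k \<Phi>"
    unfolding cond_A_def
  proof (intro conjI allI)
    fix M :: int
    show "\<exists>n\<ge>M. \<Phi> n = \<Phi> (n + 1)"
      by (rule exI[of _ "max M (b + 1)"]) (auto simp: \<Phi>_def)
    have "\<Phi> (- n - 1) = \<Phi> (- n) - k" if "n > - a" for n
      using that \<open>a < b\<close> by (simp add: \<Phi>_def algebra_simps)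
    then show "\<exists>n\<ge>M. \<Phi> (- n - 1) = \<Phi> (- n) - k"
      by (intro exI[of _ "max M (1 - a)"]) auto
  qed
  show "\<Phi> i = v i" if "a \<le> i" "i \<le> b" for i
    using that by (simp add: \<Phi>_def)
qed

text \<open>The two end rows are the issue. Row \<open>a + 1\<close> with
  \<open>g (a + 1) = 0\<close> settles the left one. On the right \<open>g (b - 1)\<close> may be
  nonzero, so constancy is needed one index before the tail: \<open>k > 0\<close> provides it, and
  for \<open>k = 0\<close> the sign of \<open>g (b - 1)\<close> does.\<close>

lemma eigenvector_truncation:
  fixes \<Phi> :: "int \<Rightarrow> real"
  assumes fixed: "mp_fixed UNIV (A_mat k g) \<Phi>" and "cond_A k \<Phi>" "k \<ge> 0" "a < b"
    and right: "\<And>i. i \<ge> b \<Longrightarrow> g i = 0"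
    and left: "\<And>i. i \<le> a + 1 \<Longrightarrow> g i = 0"
    and "k > 0 \<or> g (b - 1) \<ge> 0"
  shows "mp_fixed {a..b} (A_mat k g) \<Phi>"
proof -
  note row = mp_fixed_A_mat_row[OF fixed]
  have "\<Phi> a = \<Phi> (a + 1) - k"
    using left_tail_slope[OF fixed \<open>cond_A k \<Phi>\<close> \<open>k \<ge> 0\<close> left, of "a + 1" "a + 1"] by simp
  moreover have "\<Phi> b = \<Phi> (b - 1)"
  proof (cases "k > 0")
    case True
    then show ?thesis
      using right_tail_const[OF fixed \<open>cond_A k \<Phi>\<close> \<open>k \<ge> 0\<close> right, of b "b - 1"] by simp
  next
    case False
    with assms have "k = 0" "g (b - 1) \<ge> 0" by auto
    \<comment> \<open>Row \<open>b\<close> gives \<open>\<Phi> (b - 1) \<le> \<Phi> b\<close>, and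
      row \<open>b - 1\<close> the reverse.\<close>
    then show ?thesis
      using row[of b] row[of "b - 1"] right[of b] unfolding diff_add_cancel by linarith
  qed
  ultimately show ?thesis
    unfolding mp_fixed_A_mat_interval[OF \<open>a < b\<close>]
    using left[of a] right[of b] by (intro conjI allI impI row) simp_all
qed

section \<open>Sign of \<gamma> at the right end\<close>

lemma eigenvector_imp_two_cycle_le_0:
  fixes x :: "int \<Rightarrow> real"
  assumes "mp_fixed UNIV (A_mat k g) x"
  shows "g i + g (i + 1) \<le> k"
  \<comment> \<open>Row \<open>i\<close> bounds \<open>x i\<close> below through
    \<open>x (i + 1)\<close>, row \<open>i + 1\<close> conversely; in the sum the entries of
    \<open>x\<close> cancel.\<close>
  using mp_fixed_A_mat_row[OF assms, of i] mp_fixed_A_mat_row[OF assms, of "i + 1"]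
  unfolding add_diff_cancel_right' by linarith

lemma gamma_nonneg_at_end:
  assumes cycle: "\<And>i. gamma_seq u i + gamma_seq u (i + 1) \<le> 0"
    and right: "u N = 0"
    and left: "\<And>i. i \<le> a \<Longrightarrow> u i = 0"
  shows "gamma_seq u N \<ge> 0"
proof (rule ccontr)
  assume "\<not> gamma_seq u N \<ge> 0"
  then have "u (N - 1) > 1"
    using right by (auto simp: gamma_seq_def)
  then have "u (N - 1) + u N \<ge> 1"
    using right by simp
  \<comment> \<open>The bound at \<open>i\<close> means
    \<open>gamma_seq u i = 1 - u (i - 1)\<close>, so \<open>cycle\<close> gives
    \<open>gamma_seq u (i - 1) \<le> u (i - 1) - 1\<close>. This minimum cannot be
    \<open>u (i - 1)\<close>, hence \<open>u (i - 2) + u (i - 1) \<ge> 2\<close>.\<close>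
  have "u (i - 1) + u i \<ge> 1" if "i \<le> N" for i
    using that
  proof (induction i rule: int_le_induct)
    case base
    show ?case using \<open>u (N - 1) + u N \<ge> 1\<close> .
  next
    case (step i)
    then show ?case
      using cycle[of "i - 1"] by (auto simp: gamma_seq_def min_def split: if_splits)
  qed
  from this[of "min N a"] show False
    using left[of "min N a"] left[of "min N a - 1"] by simp
qed

theorem proposition2p7:
  fixes u :: "int \<Rightarrow> real" and N :: int and k :: real and A :: "int \<Rightarrow> int \<Rightarrow> ereal"
  assumes "N \<ge> 0"
    and "\<And>i. i \<ge> N \<Longrightarrow> u i = 0"
    and "\<And>i. i \<le> - N \<Longrightarrow> u i = 0"
    and "k \<ge> 0"
    and "A = A_mat k (gamma_seq u) \<or> A = A_mat k (delta_seq u)"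
  shows "(\<forall>v \<in> extensional {- N - 1..N + 1}.
        mp_fixed {- N - 1..N + 1} A v \<longrightarrow>
        (\<exists>!\<Phi>. cond_A k \<Phi> \<and> mp_fixed UNIV A \<Phi> \<and> restrict \<Phi> {- N - 1..N + 1} = v)) \<and>
    (k > 0 \<or> A = A_mat k (gamma_seq u) \<or> u (N - 1) \<ge> 0 \<longrightarrow>
      (\<forall>\<Phi>. cond_A k \<Phi> \<and> mp_fixed UNIV A \<Phi> \<longrightarrow>
        mp_fixed {- N - 1..N + 1} A (restrict \<Phi> {- N - 1..N + 1})))"
proof -
  let ?a = "- N - 1" and ?b = "N + 1"
  obtain g where A: "A = A_mat k g" and g: "g = gamma_seq u \<or> g = delta_seq u"
    using assms(5) by blast
  have right: "g i = 0" if "i \<ge> ?b" for i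
    using g that assms(2) by (auto simp: gamma_seq_def delta_seq_def)
  have left: "g i = 0" if "i \<le> ?a + 1" for i
    using g that assms(3) by (auto simp: gamma_seq_def delta_seq_def)
  have "?a < ?b" using \<open>N \<ge> 0\<close> by simp
  have "\<exists>!\<Phi>. cond_A k \<Phi> \<and> mp_fixed UNIV A \<Phi> \<and> restrict \<Phi> {?a..?b} = v"
    if v: "v \<in> extensional {?a..?b}" and fixed: "mp_fixed {?a..?b} A v" for v
  proof (rule ex_ex1I)
    obtain \<Phi> where \<Phi>: "mp_fixed UNIV A \<Phi>" "cond_A k \<Phi>" "\<And>i. ?a \<le> i \<Longrightarrow> i \<le> ?b \<Longrightarrow> \<Phi> i = v i"
      using eigenvector_extension[of ?a ?b k g v] fixed right left \<open>k \<ge> 0\<close> \<open>?a < ?b\<close>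
      unfolding A by auto
    moreover have "restrict \<Phi> {?a..?b} = v"
      using v by (intro extensionalityI[of _ "{?a..?b}"]) (simp_all add: \<Phi>(3))
    ultimately show "\<exists>\<Phi>. cond_A k \<Phi> \<and> mp_fixed UNIV A \<Phi> \<and> restrict \<Phi> {?a..?b} = v"
      by blast
  next
    fix \<Phi> \<Psi>
    assume \<Phi>: "cond_A k \<Phi> \<and> mp_fixed UNIV A \<Phi> \<and> restrict \<Phi> {?a..?b} = v"
      and \<Psi>: "cond_A k \<Psi> \<and> mp_fixed UNIV A \<Psi> \<and> restrict \<Psi> {?a..?b} = v"
    have "\<Phi> i = \<Psi> i" if "?a \<le> i" "i \<le> ?b" for i
    proof -
      have "restrict \<Phi> {?a..?b} i = restrict \<Psi> {?a..?b} i"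
        using \<Phi> \<Psi> by simp
      with that show ?thesis by simp
    qed
    then show "\<Phi> = \<Psi>"
      using \<Phi> \<Psi> right left \<open>k \<ge> 0\<close> \<open>?a < ?b\<close> unfolding A
      by (intro eigenvector_unique[of k g \<Phi> \<Psi> ?a ?b]) auto
  qed
  moreover have "mp_fixed {?a..?b} A (restrict \<Phi> {?a..?b})"
    if pos: "k > 0 \<or> A = A_mat k (gamma_seq u) \<or> u (N - 1) \<ge> 0"
      and \<Phi>: "cond_A k \<Phi>" "mp_fixed UNIV A \<Phi>" for \<Phi>
  proof -
    have "g N \<ge> 0" if "k = 0"
    proof (cases "A = A_mat k (gamma_seq u)")
      case True
      have "gamma_seq u i + gamma_seq u (i + 1) \<le> 0" for i
        using eigenvector_imp_two_cycle_le_0[of k "gamma_seq u" \<Phi> i] \<Phi>(2) True that by simp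
      then have "gamma_seq u N \<ge> 0"
        by (rule gamma_nonneg_at_end[where a = "- N"]) (use assms in auto)
      \<comment> \<open>\<open>g\<close> was chosen only up to the matrix it defines; this entry
        recovers its value at \<open>N\<close>.\<close>
      moreover have "A_mat k g N (N - 1) = A_mat k (gamma_seq u) N (N - 1)"
        using A True by simp
      ultimately show ?thesis
        by (simp add: A_mat_def)
    next
      case False
      \<comment> \<open>Here \<open>g N\<close> is the minimum of \<open>u (N - 1)\<close> and 1, so
        the assumed sign of \<open>u (N - 1)\<close> decides.\<close>
      with pos that g A show ?thesis
        using assms(2)[of N] by (auto simp: delta_seq_def)
    qed
    then have "k > 0 \<or> g (?b - 1) \<ge> 0"
      using \<open>k \<ge> 0\<close> by (cases "k = 0") auto
    then have "mp_fixed {?a..?b} A \<Phi>"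
      using \<Phi> right left \<open>k \<ge> 0\<close> \<open>?a < ?b\<close> unfolding A
      by (intro eigenvector_truncation) auto
    then show ?thesis
      by (simp only: mp_fixed_restrict)
  qed
  ultimately show ?thesis by blast
qed

end
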